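(* Let $p\equiv 1\pmod 4$ be a prime, let $m\in\{1,\dots,p-1\}$ be a quadratic non-residue modulo $p$, and let $M$ be any positive integer with $M\equiv m\pmod p$. Then $$-M\,F(M)\equiv \left[\frac{M}{p}\right]+\sum_{j=1}^{m-1}H_{\left[\frac{pj}{m}\right]}\pmod p .$$
   Context: $[x]$ denotes the floor of $x$. For an integer $a$ prime to $p$, $F(a)=\frac{a^{p-1}-1}{p}$ is the Fermat quotient. $H_k=\sum_{j=1}^k \frac1j$ is the $k$-th harmonic number, with $H_0=0$. Congruences modulo $p$ between rational numbers whose denominators are prime to $p$ are understood in the localization $\mathbb{Z}_{(p)}$. *)

theory Defs
  imports "HOL-Number_Theory.Number_Theory"
begin

text \<open>The localization of the integers at the prime ideal \<open>(p)\<close>, as a subring of the rationals.\<close>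

definition Z_loc :: "nat \<Rightarrow> rat set" where
  "Z_loc p = {of_int a / of_int b | a b :: int. coprime b (int p)}"

definition loc_cong :: "nat \<Rightarrow> rat \<Rightarrow> rat \<Rightarrow> bool" where
  "loc_cong p x y \<longleftrightarrow>
     x \<in> Z_loc p \<and> y \<in> Z_loc p \<and> (\<exists>z \<in> Z_loc p. x - y = of_nat p * z)"

text \<open>The quotient is taken in the rationals; it is an integer when \<open>p\<close> is a prime
  not dividing \<open>a\<close>.\<close>

definition fermat_quotient :: "nat \<Rightarrow> int \<Rightarrow> rat" where
  "fermat_quotient p a = (of_int a ^ (p - 1) - 1) / of_nat p"

text \<open>The library's \<open>harm\<close> requires a real normed field, which \<open>rat\<close> is not.\<close>

definition harmonic :: "nat \<Rightarrow> rat" where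
  "harmonic k = (\<Sum>j = 1..k. 1 / of_nat j)"

end

theory Submission
  imports Defs
begin

text \<open>
  Let \<open>r\<^sub>k = M k mod p\<close> for \<open>k = 1, \<dots>, p - 1\<close>. The \<open>r\<^sub>k\<close> permute the \<open>k\<close>, so multiplying the
  equations \<open>M k = r\<^sub>k (1 + p [M k / p] / r\<^sub>k)\<close> and reducing modulo \<open>p\<^sup>2\<close> gives Lerch's congruence
  \<open>M F(M) \<equiv> (\<Sum>k = 1..p-1. [M k / p] / k)\<close>. With \<open>t = [M / p]\<close> we have \<open>[M k / p] = t k + [m k / p]\<close>,
  where \<open>[m k / p]\<close> counts the \<open>j \<in> {1..m-1}\<close> with \<open>p j / m < k\<close>. Exchanging the two
  summations turns the right-hand side into \<open>t (p - 1)\<close> plus the sum over \<open>j\<close> of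
  \<open>H\<^bsub>p-1\<^esub> - H\<^bsub>[p j / m]\<^esub>\<close>, and \<open>H\<^bsub>p-1\<^esub> \<equiv> 0\<close>.
\<close>

section \<open>Closure properties of the localization at \<open>p\<close>\<close>

lemma Z_loc_of_int: "of_int a \<in> Z_loc p"
  unfolding Z_loc_def by (intro CollectI exI[of _ a] exI[of _ 1]) simp

lemma Z_loc_of_nat: "of_nat a \<in> Z_loc p"
  using Z_loc_of_int[of "int a"] by simp

lemma Z_loc_0: "0 \<in> Z_loc p"
  using Z_loc_of_int[of 0] by simp

lemma Z_loc_inverse_of_nat:
  assumes "coprime b p"
  shows "1 / of_nat b \<in> Z_loc p"
  unfolding Z_loc_def using assms
  by (intro CollectI exI[of _ 1] exI[of _ "int b"]) simp

context
  fixes p :: nat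
  assumes p: "prime p"
begin

lemma coprime_imp_nonzero:
  assumes "coprime b (int p)"
  shows "b \<noteq> 0"
  using assms p by (auto simp: prime_gt_1_nat)

lemma Z_loc_add:
  assumes "x \<in> Z_loc p" "y \<in> Z_loc p"
  shows "x + y \<in> Z_loc p"
proof -
  obtain a b c d where *: "x = of_int a / of_int b" "coprime b (int p)"
    "y = of_int c / of_int d" "coprime d (int p)"
    using assms unfolding Z_loc_def by blast
  then have "x + y = of_int (a * d + c * b) / of_int (b * d)"
    using coprime_imp_nonzero by (simp add: add_frac_eq)
  moreover have "coprime (b * d) (int p)"
    using * by simp
  ultimately show ?thesis
    unfolding Z_loc_def by blast
qed

lemma Z_loc_mult:
  assumes "x \<in> Z_loc p" "y \<in> Z_loc p"
  shows "x * y \<in> Z_loc p"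
proof -
  obtain a b c d where *: "x = of_int a / of_int b" "coprime b (int p)"
    "y = of_int c / of_int d" "coprime d (int p)"
    using assms unfolding Z_loc_def by blast
  then have "x * y = of_int (a * c) / of_int (b * d)"
    by simp
  moreover have "coprime (b * d) (int p)"
    using * by simp
  ultimately show ?thesis
    unfolding Z_loc_def by blast
qed

lemma Z_loc_uminus: "x \<in> Z_loc p \<Longrightarrow> - x \<in> Z_loc p"
  using Z_loc_mult[of "- 1" x] Z_loc_of_int[of "- 1" p] by simp

lemma Z_loc_diff: "x \<in> Z_loc p \<Longrightarrow> y \<in> Z_loc p \<Longrightarrow> x - y \<in> Z_loc p"
  using Z_loc_add[of x "- y"] Z_loc_uminus[of y] by simp

lemma Z_loc_sum: "(\<And>k. k \<in> A \<Longrightarrow> f k \<in> Z_loc p) \<Longrightarrow> sum f A \<in> Z_loc p"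
  by (induction A rule: infinite_finite_induct) (auto simp: Z_loc_0 Z_loc_add)

text \<open>Every denominator met below (\<open>k\<close>, \<open>r k\<close>, \<open>p - k\<close>
  and \<open>2\<close>) lies strictly between \<open>0\<close> and \<open>p\<close>, hence is a unit
  of the localization.\<close>

lemma Z_loc_divide_of_nat:
  assumes "x \<in> Z_loc p" "0 < k" "k < p"
  shows "x / of_nat k \<in> Z_loc p"
proof -
  have "coprime k p"
    using assms p by (metis coprime_commute nat_dvd_not_less prime_imp_coprime)
  then show ?thesis
    using Z_loc_mult[OF assms(1) Z_loc_inverse_of_nat] by simp
qed

lemma harmonic_Z_loc:
  assumes "n < p"
  shows "harmonic n \<in> Z_loc p"
  unfolding harmonic_def using assms
  by (intro Z_loc_sum Z_loc_divide_of_nat) (auto simp: Z_loc_of_int[of 1, simplified])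

section \<open>Lerch's congruence\<close>

lemma prod_one_plus_p_times:
  assumes "\<And>k. k \<in> A \<Longrightarrow> x k \<in> Z_loc p"
  shows "\<exists>z\<in>Z_loc p. (\<Prod>k\<in>A. 1 + of_nat p * x k) = 1 + of_nat p * (sum x A + of_nat p * z)"
  using assms
proof (induction A rule: infinite_finite_induct)
  case (insert a A)
  then obtain z where z: "z \<in> Z_loc p"
    "(\<Prod>k\<in>A. 1 + of_nat p * x k) = 1 + of_nat p * (sum x A + of_nat p * z)"
    by auto
  \<comment> \<open>With \<open>B = sum x A + p * z\<close>, one has \<open>(1 + p * B) * (1 + p * x
    a) = 1 + p * (B + x a + p * (x a * B))\<close>; \<open>z'\<close> gathers the coefficient of
    \<open>p^2\<close>.\<close>
  define z' where "z' = z + x a * (sum x A + of_nat p * z)"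
  have "z' \<in> Z_loc p"
    unfolding z'_def using insert.prems z(1)
    by (intro Z_loc_add Z_loc_mult Z_loc_sum Z_loc_of_nat) auto
  moreover have "(\<Prod>k\<in>insert a A. 1 + of_nat p * x k)
      = 1 + of_nat p * (sum x (insert a A) + of_nat p * z')"
    using insert.hyps z(2) by (simp add: z'_def algebra_simps)
  ultimately show ?case
    by blast
\<comment> \<open>For an empty or infinite index set the product is \<open>1\<close> and the sum is
  \<open>0\<close>, so the witness \<open>0\<close> works.\<close>
qed (auto intro!: bexI[of _ 0] simp: Z_loc_0)

text \<open>\<open>M\<close> is invertible modulo \<open>p\<close>, so the map is injective, and no
  value is \<open>0\<close>; finiteness then gives surjectivity.\<close>

lemma bij_betw_mult_mod:
  assumes "\<not> p dvd M"
  shows "bij_betw (\<lambda>k. M * k mod p) {1..p - 1} {1..p - 1}"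
proof -
  have cop: "coprime M p"
    using assms p by (metis coprime_commute prime_imp_coprime)
  have "inj_on (\<lambda>k. M * k mod p) {1..p - 1}"
  proof (rule inj_onI)
    fix k l assume kl: "k \<in> {1..p - 1}" "l \<in> {1..p - 1}" "M * k mod p = M * l mod p"
    then have "[k = l] (mod p)"
      using cop by (simp add: cong_def[symmetric] cong_mult_lcancel_nat)
    then show "k = l"
      using kl by (intro cong_less_modulus_unique_nat) auto
  qed
  moreover have "(\<lambda>k. M * k mod p) ` {1..p - 1} \<subseteq> {1..p - 1}"
  proof safe
    fix k assume k: "k \<in> {1..p - 1}"
    then have "\<not> p dvd k"
      by (auto dest: dvd_imp_le)
    then have "\<not> p dvd M * k"
      using assms p by (simp add: prime_dvd_mult_iff)
    then have "M * k mod p \<noteq> 0"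
      by (simp add: dvd_eq_mod_eq_0)
    moreover have "M * k mod p < p"
      using p by (simp add: prime_gt_0_nat)
    ultimately show "M * k mod p \<in> {1..p - 1}"
      by auto
  qed
  ultimately show ?thesis
    by (simp add: bij_betw_def endo_inj_surj)
qed

text \<open>The product argument first yields \<open>F(M)\<close> as the sum of
  \<open>q k / r k\<close> modulo \<open>p\<close>. Multiplying by \<open>M\<close> replaces the
  denominator \<open>r k\<close> by \<open>k\<close>, because \<open>M / r k\<close> and
  \<open>1 / k\<close> agree modulo \<open>p\<close>. All error terms are kept as explicit
  witnesses.\<close>

lemma lerch:
  assumes "\<not> p dvd M"
  shows "\<exists>z\<in>Z_loc p. of_nat M * fermat_quotient p (int M)
    = (\<Sum>k = 1..p - 1. of_nat (M * k div p) / of_nat k) + of_nat p * z"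
proof -
  define r q where "r k = M * k mod p" and "q k = M * k div p" for k
  define S :: rat where "S = (\<Sum>k = 1..p - 1. of_nat (q k) / of_nat (r k))"
  define P :: rat where "P = (\<Prod>k = 1..p - 1. of_nat k)"
  have p0: "of_nat p \<noteq> (0 :: rat)"
    using p by auto
  have P0: "P \<noteq> 0"
    by (auto simp: P_def)
  have bij: "bij_betw r {1..p - 1} {1..p - 1}"
    unfolding r_def using bij_betw_mult_mod[OF assms] .
  have r: "0 < r k" "r k < p" if "k \<in> {1..p - 1}" for k
    using bij_betw_apply[OF bij that] by auto
  have Mk: "(of_nat M * of_nat k :: rat) = of_nat (r k) + of_nat p * of_nat (q k)" for k
    unfolding r_def q_def by (metis mod_mult_div_eq of_nat_add of_nat_mult)
  have "of_nat M ^ (p - 1) * P = (\<Prod>k = 1..p - 1. of_nat M * of_nat k)"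
    by (simp add: P_def prod.distrib)
  also have "\<dots> = (\<Prod>k = 1..p - 1. of_nat (r k) * (1 + of_nat p * (of_nat (q k) / of_nat (r k))))"
    unfolding Mk using r by (intro prod.cong) (auto simp: field_simps)
  \<comment> \<open>Since \<open>r\<close> permutes the index set, the product of the
    \<open>r k\<close> is again \<open>P\<close>, which can be cancelled.\<close>
  also have "\<dots> = P * (\<Prod>k = 1..p - 1. 1 + of_nat p * (of_nat (q k) / of_nat (r k)))"
    using prod.reindex_bij_betw[OF bij, of "of_nat :: nat \<Rightarrow> rat"]
    by (simp add: P_def prod.distrib)
  finally have pow: "of_nat M ^ (p - 1)
      = (\<Prod>k = 1..p - 1. 1 + of_nat p * (of_nat (q k) / of_nat (r k) :: rat))"
    using P0 by simp
  have "\<exists>z\<in>Z_loc p. (\<Prod>k = 1..p - 1. 1 + of_nat p * (of_nat (q k) / of_nat (r k)))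
      = 1 + of_nat p * (S + of_nat p * z)"
    unfolding S_def using r
    by (intro prod_one_plus_p_times Z_loc_divide_of_nat Z_loc_of_nat) auto
  then obtain z where z: "z \<in> Z_loc p" "of_nat M ^ (p - 1) = 1 + of_nat p * (S + of_nat p * z)"
    using pow by auto
  have F: "fermat_quotient p (int M) = S + of_nat p * z"
    using z(2) p0 by (simp add: fermat_quotient_def)
  \<comment> \<open>Dividing \<open>M * k = r k + p * q k\<close> by \<open>r k * k\<close> gives
    \<open>M / r k = 1 / k + p * q k / (r k * k)\<close>; multiplying by \<open>q k\<close> and
    summing leaves \<open>p * w\<close> as the error.\<close>
  define w :: rat where "w = (\<Sum>k = 1..p - 1. of_nat (q k ^ 2) / of_nat (r k) / of_nat k)"
  have "of_nat M * S = (\<Sum>k = 1..p - 1. of_nat (q k) / of_nat k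
      + of_nat p * (of_nat (q k ^ 2) / of_nat (r k) / of_nat k))"
    unfolding S_def sum_distrib_left
  proof (intro sum.cong refl)
    fix k assume k: "k \<in> {1..p - 1}"
    have "of_nat M * (of_nat (q k) / of_nat (r k))
        = of_nat (q k) * (of_nat M * of_nat k) / (of_nat (r k) * of_nat k :: rat)"
      using k by simp
    also have "\<dots> = of_nat (q k) / of_nat k
      + of_nat p * (of_nat (q k ^ 2) / of_nat (r k) / of_nat k)"
      unfolding Mk using k r[OF k] by (simp add: field_simps power2_eq_square)
    finally show "of_nat M * (of_nat (q k) / of_nat (r k)) = of_nat (q k) / of_nat k
      + of_nat p * (of_nat (q k ^ 2) / of_nat (r k) / of_nat k :: rat)" .
  qed
  then have "of_nat M * S = (\<Sum>k = 1..p - 1. of_nat (q k) / of_nat k) + of_nat p * w"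
    by (simp only: sum.distrib sum_distrib_left w_def)
  then have "of_nat M * fermat_quotient p (int M)
      = (\<Sum>k = 1..p - 1. of_nat (q k) / of_nat k) + of_nat p * (w + of_nat M * z)"
    unfolding F by (simp add: algebra_simps)
  moreover have "w + of_nat M * z \<in> Z_loc p"
    unfolding w_def using r z(1)
    by (intro Z_loc_add Z_loc_sum Z_loc_divide_of_nat Z_loc_mult Z_loc_of_nat) auto
  ultimately show ?thesis
    unfolding q_def by blast
qed

section \<open>Harmonic sums and the exchange of summations\<close>

lemma harmonic_p_minus_1:
  assumes "p \<noteq> 2"
  shows "\<exists>z\<in>Z_loc p. harmonic (p - 1) = of_nat p * z"
proof -
  \<comment> \<open>Pairing \<open>k\<close> with \<open>p - k\<close>:
    \<open>1 / k + 1 / (p - k) = p / (k * (p - k))\<close>. This computes twice the harmonic number,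
    and \<open>2\<close> is a unit because \<open>p\<close> is odd.\<close>
  define w :: rat where "w = (\<Sum>k = 1..p - 1. 1 / of_nat k / of_nat (p - k))"
  have "harmonic (p - 1) = (\<Sum>k = 1..p - 1. 1 / of_nat (p - k))"
    unfolding harmonic_def
    by (rule sum.reindex_bij_witness[where i = "\<lambda>k. p - k" and j = "\<lambda>k. p - k"]) auto
  then have "2 * harmonic (p - 1) = (\<Sum>k = 1..p - 1. 1 / of_nat k + 1 / of_nat (p - k))"
    by (simp add: harmonic_def sum.distrib)
  also have "\<dots> = (\<Sum>k = 1..p - 1. of_nat p * (1 / of_nat k / of_nat (p - k)))"
    by (intro sum.cong) (auto simp: field_simps of_nat_diff)
  also have "\<dots> = of_nat p * w"
    by (simp add: w_def sum_distrib_left)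
  finally have "harmonic (p - 1) = of_nat p * (w / of_nat 2)"
    by simp
  moreover have "w / of_nat 2 \<in> Z_loc p"
    unfolding w_def using prime_gt_1_nat[OF p] assms
    by (intro Z_loc_divide_of_nat Z_loc_sum) (auto simp: Z_loc_of_int[of 1, simplified])
  ultimately show ?thesis
    by blast
qed

text \<open>An exact identity in the rationals: both sides sum \<open>1 / k\<close> over the lattice
  points \<open>(k, j)\<close> with \<open>p * j \<le> m * k\<close>, by columns and by
  rows.\<close>

lemma sum_floor_over_k:
  assumes m: "m \<in> {1..p - 1}"
  shows "(\<Sum>k = 1..p - 1. of_nat (m * k div p) / of_nat k)
    = (\<Sum>j = 1..m - 1. harmonic (p - 1) - harmonic (p * j div m))"
proof -
  have count: "of_nat (m * k div p) = (\<Sum>j = 1..m - 1. if p * j \<le> m * k then 1 else 0 :: rat)"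
    if k: "k \<in> {1..p - 1}" for k
  proof -
    \<comment> \<open>This bounds the quotient by \<open>m - 1\<close>, so restricting
      \<open>j\<close> to \<open>{1..m - 1}\<close> loses no point of the count.\<close>
    have "m * k < m * p"
      using k m by auto
    then have "m * k div p < m"
      by (simp add: less_mult_imp_div_less)
    moreover have "p * j \<le> m * k \<longleftrightarrow> j \<le> m * k div p" for j
      using p by (simp add: less_eq_div_iff_mult_less_eq prime_gt_0_nat mult.commute)
    ultimately have *: "{j \<in> {1..m - 1}. p * j \<le> m * k} = {1..m * k div p}"
      by (simp only: set_eq_iff mem_Collect_eq atLeastAtMost_iff) linarith
    have "(\<Sum>j = 1..m - 1. if p * j \<le> m * k then 1 else 0 :: rat)
        = (\<Sum>j\<in>{j \<in> {1..m - 1}. p * j \<le> m * k}. 1)"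
      by (rule sum.inter_filter[symmetric]) simp
    then show ?thesis
      unfolding * by simp
  qed
  have tail: "(\<Sum>k = 1..p - 1. (if p * j \<le> m * k then 1 else 0) / of_nat k)
      = harmonic (p - 1) - harmonic (p * j div m)" if j: "j \<in> {1..m - 1}" for j
  proof -
    have "p * j < p * m"
      using j prime_gt_0_nat[OF p] by auto
    then have le: "p * j div m < p"
      by (simp add: less_mult_imp_div_less)
    \<comment> \<open>No lattice point lies on the line, as \<open>p\<close> divides neither
      \<open>m\<close> nor \<open>k\<close>. Hence the complement of
      \<open>p * j \<le> m * k\<close> is exactly \<open>k \<le> p * j div m\<close>, boundary
      included.\<close>
    have ne: "m * k \<noteq> p * j" if "k \<in> {1..p - 1}" for k
    proof
      assume "m * k = p * j"
      then have "p dvd m \<or> p dvd k"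
        using p by (metis dvd_triv_left prime_dvd_mult_iff)
      then show False
        using that m by (auto dest: dvd_imp_le)
    qed
    have "k \<le> p * j div m \<longleftrightarrow> \<not> p * j \<le> m * k" if "k \<in> {1..p - 1}" for k
      using m ne[OF that] by (auto simp: less_eq_div_iff_mult_less_eq mult.commute)
    then have "(\<Sum>k = 1..p - 1. (if p * j \<le> m * k then 1 else 0) / of_nat k :: rat)
        = (\<Sum>k = 1..p - 1. 1 / of_nat k - (if k \<le> p * j div m then 1 / of_nat k else 0))"
      by (intro sum.cong) auto
    also have "(\<Sum>k = 1..p - 1. if k \<le> p * j div m then 1 / of_nat k else 0 :: rat)
        = harmonic (p * j div m)"
      unfolding harmonic_def using le by (intro sum.mono_neutral_cong_right) auto
    then have "(\<Sum>k = 1..p - 1. 1 / of_nat k - (if k \<le> p * j div m then 1 / of_nat k else 0 :: rat))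
        = harmonic (p - 1) - harmonic (p * j div m)"
      by (simp add: sum_subtractf harmonic_def)
    finally show ?thesis .
  qed
  have "(\<Sum>k = 1..p - 1. of_nat (m * k div p) / of_nat k :: rat)
      = (\<Sum>k = 1..p - 1. \<Sum>j = 1..m - 1. (if p * j \<le> m * k then 1 else 0) / of_nat k)"
    by (intro sum.cong refl) (simp only: count sum_divide_distrib)
  also have "\<dots> = (\<Sum>j = 1..m - 1. \<Sum>k = 1..p - 1. (if p * j \<le> m * k then 1 else 0) / of_nat k)"
    by (rule sum.swap)
  also have "\<dots> = (\<Sum>j = 1..m - 1. harmonic (p - 1) - harmonic (p * j div m))"
    by (intro sum.cong refl) (simp only: tail)
  finally show ?thesis .
qed

section \<open>Assembling the congruence\<close>

lemma mult_fermat_quotient_cong: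
  assumes "p \<noteq> 2" and m: "m \<in> {1..p - 1}" and "[M = m] (mod p)"
  shows "loc_cong p
    (- (of_nat M * fermat_quotient p (int M)))
    (of_nat (M div p) + (\<Sum>j = 1..m - 1. harmonic (p * j div m)))"
proof -
  define t where "t = M div p"
  define H where "H = (\<Sum>j = 1..m - 1. harmonic (p * j div m))"
  have "M mod p = m"
    using assms by (auto simp: cong_def)
  then have M: "M = p * t + m"
    unfolding t_def by (metis mult_div_mod_eq)
  have "\<not> p dvd m"
    using m by (auto dest: dvd_imp_le)
  then have "\<not> p dvd M"
    by (simp add: M dvd_add_right_iff)
  from lerch[OF this] obtain z where z: "z \<in> Z_loc p" "of_nat M * fermat_quotient p (int M)
      = (\<Sum>k = 1..p - 1. of_nat (M * k div p) / of_nat k) + of_nat p * z"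
    by blast
  from harmonic_p_minus_1[OF \<open>p \<noteq> 2\<close>] obtain h where h: "h \<in> Z_loc p"
      "harmonic (p - 1) = of_nat p * h"
    by blast
  have "M * k div p = t * k + m * k div p" for k
    using p by (simp add: M distrib_right mult.assoc prime_gt_0_nat)
  then have "(\<Sum>k = 1..p - 1. of_nat (M * k div p) / of_nat k :: rat)
      = (\<Sum>k = 1..p - 1. of_nat t + of_nat (m * k div p) / of_nat k)"
    by (intro sum.cong) (auto simp: field_simps)
  also have "\<dots> = of_nat (p - 1) * of_nat t + (\<Sum>j = 1..m - 1. harmonic (p - 1) - harmonic (p * j div m))"
    unfolding sum.distrib sum_floor_over_k[OF m] by simp
  also have "\<dots> = (of_nat p - 1) * of_nat t + of_nat (m - 1) * (of_nat p * h) - H"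
    unfolding h(2) using prime_ge_1_nat[OF p] by (simp add: H_def sum_subtractf of_nat_diff)
  \<comment> \<open>The multiple of \<open>p\<close> collects \<open>t\<close> from
    \<open>(p - 1) * t\<close>, \<open>(m - 1) * h\<close> from the \<open>m - 1\<close> copies of
    \<open>harmonic (p - 1)\<close>, and \<open>z\<close> from Lerch's congruence.\<close>
  finally have eq: "- (of_nat M * fermat_quotient p (int M))
      = (of_nat t + H) - of_nat p * (of_nat t + of_nat (m - 1) * h + z)" (is "?L = ?R - _ * ?e")
    using z(2) by (simp add: algebra_simps)
  have e: "?e \<in> Z_loc p"
    using z h by (intro Z_loc_add Z_loc_mult Z_loc_of_nat)
  have "p * j div m < p" if "j \<in> {1..m - 1}" for j
    using that prime_gt_0_nat[OF p] by (intro less_mult_imp_div_less) auto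
  then have R: "?R \<in> Z_loc p"
    unfolding H_def by (intro Z_loc_add Z_loc_sum Z_loc_of_nat harmonic_Z_loc)
  \<comment> \<open>The Fermat quotient is defined with denominator \<open>p\<close>, so its
    integrality is read off from \<open>eq\<close>.\<close>
  have "?L \<in> Z_loc p"
    unfolding eq using R e by (intro Z_loc_diff Z_loc_mult Z_loc_of_nat)
  moreover have "?L - ?R = of_nat p * (- ?e)"
    unfolding eq by (simp only: mult_minus_right)
  ultimately show ?thesis
    using R Z_loc_uminus[OF e] unfolding loc_cong_def t_def H_def by blast
qed

end

theorem theorem3p7:
  fixes p m M :: nat
  assumes "prime p"
    and "[p = 1] (mod 4)"
    and "m \<in> {1..p - 1}"
    and "\<not> QuadRes (int p) (int m)"
    and "M > 0"
    and "[M = m] (mod p)"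
  shows "loc_cong p
    (- (of_nat M * fermat_quotient p (int M)))
    (of_int \<lfloor>of_nat M / of_nat p :: rat\<rfloor>
      + (\<Sum>j = 1..m - 1. harmonic (nat \<lfloor>of_nat (p * j) / of_nat m :: rat\<rfloor>)))"
proof -
  have "p \<noteq> 2"
    using assms(2) by (auto simp: cong_def)
  \<comment> \<open>Both kinds of rational floor in the statement become natural-number
    quotients.\<close>
  moreover have "nat \<lfloor>of_nat a / of_nat b :: rat\<rfloor> = a div b"
    "of_int \<lfloor>of_nat a / of_nat b :: rat\<rfloor> = (of_nat (a div b) :: rat)" for a b :: nat
    unfolding floor_divide_of_nat_eq by simp_all
  ultimately show ?thesis
    using mult_fermat_quotient_cong[OF assms(1) _ assms(3,6)] by presburger
qed

end
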